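(* Let $G$ be a compact Vilenkin group. Then the dimension of a (symmetric) random walk on $G$ is zero: $\mathrm{d}_{RW}^G=0$.
   Context: A topological group $G$ is a compact Vilenkin group if it possesses a strictly decreasing sequence $G=G_0\supset G_1\supset G_2\supset\cdots$ of compact open normal subgroups of $G$ such that (i) $2\le |G_n/G_{n+1}|<\infty$ for all $n\in\mathbb{N}_0$; (ii) $(G_n)_{n\in\mathbb{N}_0}$ is a basis of neighbourhoods at the identity $e$ and $\bigcap_{n}G_n=\{e\}$. Dimension of a symmetric random walk: let $G$ be a compact group (more generally a compact quantum group) with Haar state $\mathfrak{h}$ on $C(G)$. Let $\mathcal{R}_{\mathrm{sym}}(G)$ be the set of finite-dimensional representations $\chi$ of $G$ with $\chi=\overline{\chi}$ (i.e. equivalent to the conjugate representation). For $\chi=(\chi_{ij})\in\mathcal{R}_{\mathrm{sym}}(G)$ with $\dim\chi=k$ and $n\in\mathbb{N}$, put $$p_n^{\chi}=\frac{1}{k^{2n}}\,\mathfrak{h}\big((\chi_{11}+\chi_{22}+\cdots+\chi_{kk})^{2n}\big),$$ and define $$\mathrm{d}_{RW}^G=\sup_{\chi\in\mathcal{R}_{\mathrm{sym}}(G)}\Big(\limsup_{n\to\infty}\frac{-2\log p_n^{\chi}}{\log n}\Big).$$ *)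

theory Defs
  imports
    "HOL-Analysis.Analysis"
    "HOL-Algebra.Coset"
    "Jordan_Normal_Form.Matrix"
begin

locale topological_group = group G for G (structure) +
  fixes T :: "'a topology"
  assumes topspace_eq: "topspace T = carrier G"
    and continuous_mult: "continuous_map (prod_topology T T) T (\<lambda>(x, y). x \<otimes> y)"
    and continuous_inv: "continuous_map T T (\<lambda>x. inv x)"

text \<open>In the last two conjuncts, every \<open>N n\<close> is an open set containing the identity, so together
  with the first two they say that the \<open>N n\<close> form a neighbourhood basis at the identity.\<close>

definition vilenkin_chain :: "('a, 'b) monoid_scheme \<Rightarrow> 'a topology \<Rightarrow> (nat \<Rightarrow> 'a set) \<Rightarrow> bool" where
  "vilenkin_chain G T N \<longleftrightarrow>
     N 0 = carrier G \<and>
     (\<forall>n. N n \<lhd> G \<and> openin T (N n) \<and> compactin T (N n) \<and> N (Suc n) \<subset> N n) \<and>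
     (\<forall>n. finite (carrier (G\<lparr>carrier := N n\<rparr> Mod N (Suc n))) \<and>
          2 \<le> card (carrier (G\<lparr>carrier := N n\<rparr> Mod N (Suc n)))) \<and>
     (\<forall>U. openin T U \<and> \<one>\<^bsub>G\<^esub> \<in> U \<longrightarrow> (\<exists>n. N n \<subseteq> U)) \<and>
     (\<Inter>n. N n) = {\<one>\<^bsub>G\<^esub>}"

locale compact_vilenkin_group = topological_group +
  assumes ex_vilenkin_chain: "\<exists>N. vilenkin_chain G T N"

definition cont_functions :: "'a topology \<Rightarrow> ('a \<Rightarrow> complex) set" where
  "cont_functions T = {f. continuous_map T euclidean f}"

text \<open>Functions are total on the type \<open>'a\<close>. By linearity and positivity, \<open>h f\<close> depends
  only on the restriction of \<open>f\<close> to the carrier.\<close>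

definition is_haar_state ::
  "('a, 'b) monoid_scheme \<Rightarrow> 'a topology \<Rightarrow> (('a \<Rightarrow> complex) \<Rightarrow> complex) \<Rightarrow> bool" where
  "is_haar_state G T h \<longleftrightarrow>
     (\<forall>f\<in>cont_functions T. \<forall>g\<in>cont_functions T. h (\<lambda>x. f x + g x) = h f + h g) \<and>
     (\<forall>c. \<forall>f\<in>cont_functions T. h (\<lambda>x. c * f x) = c * h f) \<and>
     (\<forall>f\<in>cont_functions T. (\<forall>x\<in>carrier G. f x \<in> \<real>\<^sub>\<ge>\<^sub>0) \<longrightarrow> h f \<in> \<real>\<^sub>\<ge>\<^sub>0) \<and>
     h (\<lambda>x. 1) = 1 \<and>
     (\<forall>f\<in>cont_functions T. \<forall>g\<in>carrier G.
        h (\<lambda>x. f (g \<otimes>\<^bsub>G\<^esub> x)) = h f \<and> h (\<lambda>x. f (x \<otimes>\<^bsub>G\<^esub> g)) = h f)"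

text \<open>On a compact group the Haar state exists and is unique on \<open>cont_functions T\<close>; the choice
  operator only picks the irrelevant values on discontinuous functions.\<close>

definition haar_state ::
  "('a, 'b) monoid_scheme \<Rightarrow> 'a topology \<Rightarrow> ('a \<Rightarrow> complex) \<Rightarrow> complex" where
  "haar_state G T = (SOME h. is_haar_state G T h)"

definition fin_dim_rep ::
  "('a, 'b) monoid_scheme \<Rightarrow> 'a topology \<Rightarrow> nat \<Rightarrow> ('a \<Rightarrow> complex mat) \<Rightarrow> bool" where
  "fin_dim_rep G T k \<rho> \<longleftrightarrow>
     0 < k \<and>
     (\<forall>x\<in>carrier G. \<rho> x \<in> carrier_mat k k) \<and>
     \<rho> \<one>\<^bsub>G\<^esub> = 1\<^sub>m k \<and>
     (\<forall>x\<in>carrier G. \<forall>y\<in>carrier G. \<rho> (x \<otimes>\<^bsub>G\<^esub> y) = \<rho> x * \<rho> y) \<and>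
     (\<forall>i<k. \<forall>j<k. (\<lambda>x. \<rho> x $$ (i, j)) \<in> cont_functions T)"

definition conj_rep :: "('a \<Rightarrow> complex mat) \<Rightarrow> 'a \<Rightarrow> complex mat" where
  "conj_rep \<rho> = (\<lambda>x. map_mat cnj (\<rho> x))"

definition equivalent_reps ::
  "('a, 'b) monoid_scheme \<Rightarrow> nat \<Rightarrow> ('a \<Rightarrow> complex mat) \<Rightarrow> ('a \<Rightarrow> complex mat) \<Rightarrow> bool" where
  "equivalent_reps G k \<rho> \<psi> \<longleftrightarrow>
     (\<exists>P\<in>carrier_mat k k. invertible_mat P \<and> (\<forall>x\<in>carrier G. P * \<rho> x = \<psi> x * P))"

definition sym_reps ::
  "('a, 'b) monoid_scheme \<Rightarrow> 'a topology \<Rightarrow> (nat \<times> ('a \<Rightarrow> complex mat)) set" where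
  "sym_reps G T = {(k, \<rho>). fin_dim_rep G T k \<rho> \<and> equivalent_reps G k \<rho> (conj_rep \<rho>)}"

text \<open>For \<open>(k, \<rho>) \<in> sym_reps G T\<close> the trace is a continuous real-valued function taking the
  value \<open>k\<close> at the identity. Hence the Haar state of its even powers is real and strictly positive,
  so \<open>Re\<close> below loses nothing and the logarithm in \<open>rw_dim\<close> is taken at a positive number.\<close>

definition return_prob ::
  "('a, 'b) monoid_scheme \<Rightarrow> 'a topology \<Rightarrow> nat \<Rightarrow> ('a \<Rightarrow> complex mat) \<Rightarrow> nat \<Rightarrow> real" where
  "return_prob G T k \<rho> n =
     1 / real k ^ (2 * n) * Re (haar_state G T (\<lambda>x. (\<Sum>i<k. \<rho> x $$ (i, i)) ^ (2 * n)))"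

definition rw_dim :: "('a, 'b) monoid_scheme \<Rightarrow> 'a topology \<Rightarrow> ereal" where
  "rw_dim G T =
     (SUP (k, \<rho>) \<in> sym_reps G T.
        limsup (\<lambda>n. ereal (- 2 * ln (return_prob G T k \<rho> n) / ln (real n))))"

end

theory Submission
  imports Defs
begin

text \<open>
  A finite-dimensional representation \<open>\<rho>\<close> of a compact Vilenkin group is trivial on some open
  subgroup \<open>N\<^sub>m\<close>, because matrix groups have no small subgroups. If \<open>\<rho>\<close> is equivalent to its
  conjugate, its character is real, so its \<open>2n\<close>-th power is nonnegative, and it equals \<open>k\<^sup>2\<^sup>n\<close> on \<open>N\<^sub>m\<close>.
  Hence the return probabilities are bounded below by the Haar measure of \<open>N\<^sub>m\<close>, that is by
  the inverse of its index, and \<open>- 2 log p\<^sub>n / log n\<close> has nonpositive upper limit. The trivial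
  representation attains the value \<open>0\<close>. The Haar state is the limit of the means over the cosets
  of \<open>N\<^sub>n\<close>.
\<close>

section \<open>Means over finitely many cosets\<close>

text \<open>The normalized counting integral over the cosets of \<open>H\<close>, with
  \<open>f\<close> sampled at one chosen point per coset. The value depends on this choice unless
  \<open>f\<close> is constant on cosets; \<open>coset_osc_le\<close> controls the resulting
  error.\<close>

definition coset_mean :: "('a, 'b) monoid_scheme \<Rightarrow> 'a set \<Rightarrow> ('a \<Rightarrow> complex) \<Rightarrow> complex" where
  "coset_mean G H f =
     (\<Sum>C\<in>rcosets\<^bsub>G\<^esub> H. f (SOME x. x \<in> C)) / of_nat (card (rcosets\<^bsub>G\<^esub> H))"

text \<open>Uniform continuity in quantitative form: replacing one sample point by another in the
  same coset costs at most \<open>\<epsilon>\<close>.\<close>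

definition coset_osc_le :: "('a, 'b) monoid_scheme \<Rightarrow> 'a set \<Rightarrow> real \<Rightarrow> ('a \<Rightarrow> complex) \<Rightarrow> bool" where
  "coset_osc_le G H \<epsilon> f \<longleftrightarrow>
     (\<forall>C\<in>rcosets\<^bsub>G\<^esub> H. \<forall>x\<in>C. \<forall>y\<in>C. norm (f x - f y) \<le> \<epsilon>)"

lemma coset_osc_leD:
  assumes "coset_osc_le G H \<epsilon> f" "C \<in> rcosets\<^bsub>G\<^esub> H" "x \<in> C" "y \<in> C"
  shows "norm (f x - f y) \<le> \<epsilon>"
  using assms by (simp add: coset_osc_le_def)

lemma coset_mean_add: "coset_mean G H (\<lambda>x. f x + g x) = coset_mean G H f + coset_mean G H g"
  by (simp add: coset_mean_def sum.distrib add_divide_distrib)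

lemma coset_mean_mult: "coset_mean G H (\<lambda>x. c * f x) = c * coset_mean G H f"
  by (simp add: coset_mean_def sum_distrib_left)

text \<open>Fubini for two finite averages.\<close>

lemma coset_mean_swap:
  "coset_mean G H (\<lambda>x. coset_mean G K (\<lambda>y. f x y)) =
   coset_mean G K (\<lambda>y. coset_mean G H (\<lambda>x. f x y))"
  unfolding coset_mean_def sum_divide_distrib[symmetric]
  by (subst sum.swap) (simp add: mult.commute)

section \<open>Coset means under translation and change of subgroup\<close>

context group
begin

lemma some_mem_rcoset:
  assumes "subgroup H G" "C \<in> rcosets H"
  shows "(SOME x. x \<in> C) \<in> C"
proof -
  have "C \<noteq> {}" using subgroup.rcosets_non_empty[OF assms] .
  then show ?thesis by (simp add: some_in_eq)
qed

lemma rcoset_subset_carrier: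
  assumes "subgroup H G" "C \<in> rcosets H"
  shows "C \<subseteq> carrier G"
  using assms by (simp add: subgroup.rcosets_carrier is_group subsetI)

lemma card_rcosets_pos:
  assumes "subgroup H G" "finite (rcosets H)"
  shows "card (rcosets H) > 0"
  using assms subgroup.subgroup_in_rcosets[OF assms(1) is_group] by (auto simp: card_gt_0_iff)

lemma coset_mean_const:
  assumes "subgroup H G" "finite (rcosets H)"
  shows "coset_mean G H (\<lambda>x. c) = c"
  using card_rcosets_pos[OF assms] by (simp add: coset_mean_def)

lemma norm_coset_mean_diff_le:
  assumes "subgroup H G" "finite (rcosets H)"
    and "\<And>x. x \<in> carrier G \<Longrightarrow> norm (f x - g x) \<le> \<epsilon>"
  shows "norm (coset_mean G H f - coset_mean G H g) \<le> \<epsilon>"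
proof -
  let ?r = "\<lambda>C. SOME x. x \<in> C"
  have pos: "real (card (rcosets H)) > 0" using card_rcosets_pos[OF assms(1,2)] by simp
  have "norm (\<Sum>C\<in>rcosets H. f (?r C) - g (?r C)) \<le> of_nat (card (rcosets H)) * \<epsilon>"
    using some_mem_rcoset[OF assms(1)] rcoset_subset_carrier[OF assms(1)]
    by (intro sum_norm_bound assms(3)) blast
  then have "norm (\<Sum>C\<in>rcosets H. f (?r C) - g (?r C)) / card (rcosets H) \<le> \<epsilon>"
    using pos by (simp add: field_simps)
  moreover have "coset_mean G H f - coset_mean G H g =
      (\<Sum>C\<in>rcosets H. f (?r C) - g (?r C)) / of_nat (card (rcosets H))"
    unfolding coset_mean_def sum_subtractf diff_divide_distrib ..
  ultimately show ?thesis by (simp only: norm_divide norm_of_nat)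
qed

text \<open>Every coset of \<open>K\<close> lies inside a coset of \<open>H\<close>.\<close>

lemma coset_osc_le_subset:
  assumes "coset_osc_le G H \<epsilon> f" "K \<subseteq> H"
  shows "coset_osc_le G K \<epsilon> f"
  unfolding coset_osc_le_def
proof (intro ballI)
  fix C x y assume "C \<in> rcosets K" and xy: "x \<in> C" "y \<in> C"
  then obtain a where a: "a \<in> carrier G" "C = K #> a" by (auto simp: RCOSETS_def)
  have "x \<in> H #> a" "y \<in> H #> a" using xy a \<open>K \<subseteq> H\<close> by (auto simp: r_coset_def)
  moreover have "H #> a \<in> rcosets H" using a by (auto simp: RCOSETS_def)
  ultimately show "norm (f x - f y) \<le> \<epsilon>" using coset_osc_leD[OF assms(1)] by metis
qed

lemma norm_coset_mean_shift_le:
  assumes H: "subgroup H G" and fin: "finite (rcosets H)" and osc: "coset_osc_le G H \<epsilon> f"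
    and inj: "inj_on \<sigma> (carrier G)"
    and \<sigma>: "\<And>C. C \<in> rcosets H \<Longrightarrow> \<sigma> ` C \<in> rcosets H"
  shows "norm (coset_mean G H (\<lambda>x. f (\<sigma> x)) - coset_mean G H f) \<le> \<epsilon>"
proof -
  let ?r = "\<lambda>C. SOME x. x \<in> C"
  have pos: "real (card (rcosets H)) > 0" using card_rcosets_pos[OF H fin] by simp
  have inj': "inj_on ((`) \<sigma>) (rcosets H)"
    using inj rcoset_subset_carrier[OF H] by (meson inj_onI inj_on_image_eq_iff)
  have bij: "bij_betw ((`) \<sigma>) (rcosets H) (rcosets H)"
    unfolding bij_betw_def using inj' endo_inj_surj[OF fin _ inj'] \<sigma> by blast
  have eq: "(\<Sum>C\<in>rcosets H. f (?r C)) = (\<Sum>C\<in>rcosets H. f (?r (\<sigma> ` C)))"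
    by (rule sum.reindex_bij_betw[OF bij, symmetric])
  have "norm (\<Sum>C\<in>rcosets H. f (\<sigma> (?r C)) - f (?r (\<sigma> ` C))) \<le> of_nat (card (rcosets H)) * \<epsilon>"
  proof (rule sum_norm_bound)
    fix C assume C: "C \<in> rcosets H"
    have "\<sigma> (?r C) \<in> \<sigma> ` C" using some_mem_rcoset[OF H C] by blast
    moreover have "?r (\<sigma> ` C) \<in> \<sigma> ` C" using some_mem_rcoset[OF H \<sigma>[OF C]] .
    ultimately show "norm (f (\<sigma> (?r C)) - f (?r (\<sigma> ` C))) \<le> \<epsilon>"
      using coset_osc_leD[OF osc \<sigma>[OF C]] by metis
  qed
  then have "norm (\<Sum>C\<in>rcosets H. f (\<sigma> (?r C)) - f (?r (\<sigma> ` C))) / card (rcosets H) \<le> \<epsilon>"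
    using pos by (simp add: field_simps)
  moreover have "coset_mean G H (\<lambda>x. f (\<sigma> x)) - coset_mean G H f =
      (\<Sum>C\<in>rcosets H. f (\<sigma> (?r C)) - f (?r (\<sigma> ` C))) / of_nat (card (rcosets H))"
    unfolding coset_mean_def sum_subtractf diff_divide_distrib eq ..
  ultimately show ?thesis by (simp only: norm_divide norm_of_nat)
qed

lemma norm_coset_mean_right_translate_le:
  assumes H: "subgroup H G" and "finite (rcosets H)" "coset_osc_le G H \<epsilon> f" and g: "g \<in> carrier G"
  shows "norm (coset_mean G H (\<lambda>x. f (x \<otimes> g)) - coset_mean G H f) \<le> \<epsilon>"
proof (rule norm_coset_mean_shift_le[OF assms(1-3)])
  show "inj_on (\<lambda>x. x \<otimes> g) (carrier G)" using g by (simp add: inj_on_def)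
  fix C assume "C \<in> rcosets H"
  then obtain a where a: "a \<in> carrier G" "C = H #> a" by (auto simp: RCOSETS_def)
  have "(\<lambda>x. x \<otimes> g) ` C = C #> g" by (auto simp: r_coset_def)
  also have "\<dots> = H #> (a \<otimes> g)" using a g H by (simp add: coset_mult_assoc subgroup.subset)
  finally show "(\<lambda>x. x \<otimes> g) ` C \<in> rcosets H" using a g by (auto simp: RCOSETS_def)
qed

text \<open>Normality turns \<open>g <# H\<close> into \<open>H #> g\<close>, so left translation
  also permutes the right cosets.\<close>

lemma norm_coset_mean_left_translate_le:
  assumes H: "H \<lhd> G" and "finite (rcosets H)" "coset_osc_le G H \<epsilon> f" and g: "g \<in> carrier G"
  shows "norm (coset_mean G H (\<lambda>x. f (g \<otimes> x)) - coset_mean G H f) \<le> \<epsilon>"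
proof (rule norm_coset_mean_shift_le[OF normal_imp_subgroup[OF H] assms(2,3)])
  show "inj_on (\<lambda>x. g \<otimes> x) (carrier G)" using g by (simp add: inj_on_def)
  have sub: "H \<subseteq> carrier G" using normal_imp_subgroup[OF H] subgroup.subset by blast
  fix C assume "C \<in> rcosets H"
  then obtain a where a: "a \<in> carrier G" "C = H #> a" by (auto simp: RCOSETS_def)
  have "(\<lambda>x. g \<otimes> x) ` C = g <# C" by (auto simp: l_coset_def)
  also have "\<dots> = (g <# H) #> a" using a g sub by (simp add: coset_assoc)
  also have "g <# H = H #> g" using normal.coset_eq[OF H] g by simp
  also have "(H #> g) #> a = H #> (g \<otimes> a)" using a g sub by (simp add: coset_mult_assoc)
  finally show "(\<lambda>x. g \<otimes> x) ` C \<in> rcosets H" using a g by (auto simp: RCOSETS_def)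
qed

text \<open>Both means are compared with the iterated mean of \<open>f (g \<otimes> x)\<close> over \<open>g\<close> and \<open>x\<close>, the
  argument by which the Haar measure is unique; no index of \<open>K\<close> in \<open>H\<close> has to be counted.\<close>

lemma norm_coset_mean_diff_subgroup_le:
  assumes H: "H \<lhd> G" "finite (rcosets H)" and K: "K \<lhd> G" "finite (rcosets K)"
    and "K \<subseteq> H" and osc: "coset_osc_le G H \<epsilon> f"
  shows "norm (coset_mean G K f - coset_mean G H f) \<le> 2 * \<epsilon>"
proof -
  let ?D = "coset_mean G H (\<lambda>g. coset_mean G K (\<lambda>x. f (g \<otimes> x)))"
  note sH = normal_imp_subgroup[OF H(1)] and sK = normal_imp_subgroup[OF K(1)]
  have "norm (?D - coset_mean G H (\<lambda>g. coset_mean G K f)) \<le> \<epsilon>"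
    using norm_coset_mean_left_translate_le[OF K coset_osc_le_subset[OF osc \<open>K \<subseteq> H\<close>]]
    by (intro norm_coset_mean_diff_le[OF sH H(2)])
  then have 1: "norm (?D - coset_mean G K f) \<le> \<epsilon>"
    by (simp add: coset_mean_const[OF sH H(2)])
  \<comment> \<open>With the order of averaging exchanged, the inner mean over \<open>H\<close> is
    that of a right translate of \<open>f\<close>; this compares \<open>?D\<close> with the mean
    over \<open>H\<close>.\<close>
  have "norm (coset_mean G K (\<lambda>x. coset_mean G H (\<lambda>g. f (g \<otimes> x))) -
      coset_mean G K (\<lambda>x. coset_mean G H f)) \<le> \<epsilon>"
    using norm_coset_mean_right_translate_le[OF sH H(2) osc]
    by (intro norm_coset_mean_diff_le[OF sK K(2)])
  then have 2: "norm (?D - coset_mean G H f) \<le> \<epsilon>"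
    by (simp add: coset_mean_const[OF sK K(2)] coset_mean_swap[of G H])
  show ?thesis
    using norm_triangle_le_diff[of "?D - coset_mean G H f" "?D - coset_mean G K f" "2 * \<epsilon>"] 1 2
    by (simp add: norm_minus_commute)
qed

end

section \<open>The Haar state of a compact Vilenkin group\<close>

lemma cont_functions_compose:
  assumes "f \<in> cont_functions T" "continuous_on UNIV \<phi>"
  shows "(\<lambda>x. \<phi> (f x)) \<in> cont_functions T"
  using continuous_map_compose[of T euclidean f euclidean \<phi>] assms
  by (simp add: cont_functions_def o_def)

lemma cont_functions_const [simp]: "(\<lambda>x. c) \<in> cont_functions T"
  by (simp add: cont_functions_def)

lemma cont_functions_mult_left:
  "f \<in> cont_functions T \<Longrightarrow> (\<lambda>x. c * f x) \<in> cont_functions T"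
  by (erule cont_functions_compose) (intro continuous_intros)

lemma cont_functions_sum:
  assumes "finite I" "\<And>i. i \<in> I \<Longrightarrow> f i \<in> cont_functions T"
  shows "(\<lambda>x. \<Sum>i\<in>I. f i x) \<in> cont_functions T"
  using assms by (simp add: cont_functions_def continuous_map_sum)

section \<open>Open subgroups of a topological group\<close>

context topological_group
begin

lemma continuous_map_right_translate:
  assumes "g \<in> carrier G"
  shows "continuous_map T T (\<lambda>x. x \<otimes> g)"
proof -
  have "continuous_map T (prod_topology T T) (\<lambda>x. (x, g))"
    using assms by (intro continuous_map_pairedI) (auto simp: topspace_eq)
  from continuous_map_compose[OF this continuous_mult] show ?thesis by (simp add: o_def)
qed

lemma cont_functions_right_translate:
  assumes "f \<in> cont_functions T" "g \<in> carrier G"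
  shows "(\<lambda>x. f (x \<otimes> g)) \<in> cont_functions T"
  using continuous_map_compose[OF continuous_map_right_translate[OF assms(2)], of euclidean f] assms(1)
  by (simp add: cont_functions_def o_def)

lemma openin_rcoset:
  assumes H: "subgroup H G" "openin T H" and a: "a \<in> carrier G"
  shows "openin T (H #> a)"
proof -
  have "H #> a = {x \<in> topspace T. x \<otimes> inv a \<in> H}"
    using subgroup.rcos_module[OF H(1) is_group a] r_coset_subset_G[OF subgroup.subset[OF H(1)] a]
    by (auto simp: topspace_eq)
  also have "openin T \<dots>"
    using continuous_map_right_translate[of "inv a"] a H(2)
    by (intro openin_continuous_map_preimage) auto
  finally show ?thesis .
qed

text \<open>The cosets form an open cover by pairwise disjoint nonempty sets, so a finite subcover
  must already contain every coset.\<close>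

lemma finite_rcosets:
  assumes H: "subgroup H G" "openin T H" and "compactin T (carrier G)"
  shows "finite (rcosets H)"
proof -
  have "\<exists>\<F>. finite \<F> \<and> \<F> \<subseteq> rcosets H \<and> carrier G \<subseteq> \<Union>\<F>"
    using assms(3) openin_rcoset[OF H] rcosets_part_G[OF H(1)]
    by (intro compactinD) (auto simp: RCOSETS_def)
  then obtain \<F> where \<F>: "finite \<F>" "\<F> \<subseteq> rcosets H" "carrier G \<subseteq> \<Union>\<F>" by blast
  have "rcosets H \<subseteq> \<F>"
  proof
    fix C assume C: "C \<in> rcosets H"
    define x where "x = (SOME x. x \<in> C)"
    have x: "x \<in> C" "x \<in> carrier G"
      unfolding x_def using some_mem_rcoset[OF H(1) C] rcoset_subset_carrier[OF H(1) C] by auto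
    then obtain D where D: "D \<in> \<F>" "x \<in> D" using \<F>(3) by blast
    then have "C = D"
      using rcos_disjoint[OF H(1)] \<F>(2) C x unfolding pairwise_def disjnt_def by blast
    with D show "C \<in> \<F>" by simp
  qed
  then show ?thesis using \<F>(1) finite_subset by blast
qed

text \<open>An open subgroup is also closed: a point outside \<open>H\<close> has the open
  neighbourhood \<open>H #> x\<close>, which is disjoint from \<open>H\<close>.\<close>

lemma cont_functions_indicator:
  assumes H: "subgroup H G" "openin T H"
  shows "(\<lambda>x. of_bool (x \<in> H)) \<in> cont_functions T"
proof -
  have op: "openin T (carrier G - H)"
  proof (subst openin_subopen, intro ballI)
    fix x assume x: "x \<in> carrier G - H"
    have "(H #> x) \<inter> H = {}"
    proof (rule ccontr)
      assume "(H #> x) \<inter> H \<noteq> {}"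
      then obtain h where "h \<in> H" "h \<otimes> x \<in> H" by (auto simp: r_coset_def)
      then have "inv h \<otimes> (h \<otimes> x) \<in> H"
        using H(1) by (simp add: subgroup.m_closed subgroup.m_inv_closed)
      moreover have "inv h \<otimes> (h \<otimes> x) = x"
        using \<open>h \<in> H\<close> x subgroup.mem_carrier[OF H(1)] by (simp add: m_assoc[symmetric])
      ultimately show False using x by simp
    qed
    then show "\<exists>U. openin T U \<and> x \<in> U \<and> U \<subseteq> carrier G - H"
      using openin_rcoset[OF H, of x] rcos_self[OF _ H(1), of x] x
        r_coset_subset_G[OF subgroup.subset[OF H(1)], of x] by blast
  qed
  have "openin T {x \<in> topspace T. of_bool (x \<in> H) \<in> U}" for U :: "complex set"
  proof -
    have "{x \<in> topspace T. of_bool (x \<in> H) \<in> U} =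
        (if (1::complex) \<in> U then H else {}) \<union> (if (0::complex) \<in> U then carrier G - H else {})"
      using subgroup.subset[OF H(1)] by (auto simp: topspace_eq of_bool_def split: if_splits)
    then show ?thesis by (simp only:) (intro openin_Un; simp add: op H(2))
  qed
  then show ?thesis by (simp add: cont_functions_def continuous_map_def)
qed

section \<open>Consequences of the Haar state axioms\<close>

lemma haar_add:
  assumes "is_haar_state G T h" "f \<in> cont_functions T" "g \<in> cont_functions T"
  shows "h (\<lambda>x. f x + g x) = h f + h g"
  using assms unfolding is_haar_state_def by simp

text \<open>Positivity applied to \<open>K - F\<close>. Membership of the difference in the
  nonnegative reals serves as the pointwise order on complex-valued functions.\<close>

lemma haar_mono:
  assumes h: "is_haar_state G T h" and F: "F \<in> cont_functions T" and K: "K \<in> cont_functions T"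
    and le: "\<And>x. x \<in> carrier G \<Longrightarrow> K x - F x \<in> \<real>\<^sub>\<ge>\<^sub>0"
  shows "Re (h F) \<le> Re (h K)"
proof -
  have D: "(\<lambda>x. K x - F x) \<in> cont_functions T"
    using F K by (simp add: cont_functions_def continuous_map_diff)
  have "h K = h (\<lambda>x. F x + (K x - F x))" by simp
  also have "\<dots> = h F + h (\<lambda>x. K x - F x)"
    by (rule haar_add[OF h F D])
  finally show ?thesis
    using h D le unfolding is_haar_state_def by (auto simp: complex_nonneg_Reals_iff)
qed

lemma haar_mult_left:
  assumes "is_haar_state G T h" "f \<in> cont_functions T"
  shows "h (\<lambda>x. c * f x) = c * h f"
  using assms unfolding is_haar_state_def by simp

lemma haar_right_translate:
  assumes "is_haar_state G T h" "f \<in> cont_functions T" "g \<in> carrier G"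
  shows "h (\<lambda>x. f (x \<otimes> g)) = h f"
  using assms unfolding is_haar_state_def by simp

lemma haar_sum:
  assumes h: "is_haar_state G T h" and "finite I" "\<And>i. i \<in> I \<Longrightarrow> f i \<in> cont_functions T"
  shows "h (\<lambda>x. \<Sum>i\<in>I. f i x) = (\<Sum>i\<in>I. h (f i))"
  using assms(2,3)
proof (induction I rule: finite_induct)
  case empty
  show ?case using haar_mult_left[OF h, of "\<lambda>x. 0" 0] by simp
next
  case (insert i I)
  have "(\<lambda>x. \<Sum>i\<in>I. f i x) \<in> cont_functions T"
    using insert by (intro cont_functions_sum) auto
  then have "h (\<lambda>x. f i x + (\<Sum>i\<in>I. f i x)) = h (f i) + h (\<lambda>x. \<Sum>i\<in>I. f i x)"
    using insert.prems by (intro haar_add[OF h]) auto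
  then show ?case using insert by simp
qed

text \<open>Translates of the indicator of \<open>H\<close>, one for each coset, sum to at least 1
  everywhere and all have the same Haar value by invariance.\<close>

lemma haar_indicator_ge:
  assumes h: "is_haar_state G T h" and H: "subgroup H G" "openin T H" and fin: "finite (rcosets H)"
  shows "1 / card (rcosets H) \<le> Re (h (\<lambda>x. of_bool (x \<in> H)))"
proof -
  let ?r = "\<lambda>C. SOME x. x \<in> C"
  let ?f = "\<lambda>C x. of_bool (x \<otimes> inv (?r C) \<in> H) :: complex"
  have r: "?r C \<in> C" "?r C \<in> carrier G" if "C \<in> rcosets H" for C
    using some_mem_rcoset[OF H(1) that] rcoset_subset_carrier[OF H(1) that] by auto
  have cont: "?f C \<in> cont_functions T" if "C \<in> rcosets H" for C
    using cont_functions_right_translate[OF cont_functions_indicator[OF H], of "inv (?r C)"] r[OF that]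
    by simp
  have inv: "h (?f C) = h (\<lambda>x. of_bool (x \<in> H))" if "C \<in> rcosets H" for C
    using haar_right_translate[OF h cont_functions_indicator[OF H] inv_closed[OF r(2)[OF that]]] .
  have "Re (h (\<lambda>x. 1)) \<le> Re (h (\<lambda>x. \<Sum>C\<in>rcosets H. ?f C x))"
  proof (rule haar_mono[OF h cont_functions_const cont_functions_sum[OF fin cont]])
    fix x assume x: "x \<in> carrier G"
    define C where "C = H #> x"
    have C: "C \<in> rcosets H" using x by (auto simp: C_def RCOSETS_def)
    have "H #> x = H #> ?r C"
      using repr_independence[OF _ x H(1)] r(1)[OF C] unfolding C_def by blast
    then have "x \<in> H #> ?r C" using rcos_self[OF x H(1)] by simp
    then have "x \<otimes> inv (?r C) \<in> H"
      by (rule subgroup.rcos_module_imp[OF H(1) is_group r(2)[OF C]])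
    \<comment> \<open>The coset of \<open>x\<close> itself contributes 1; the remaining terms form a
      natural number.\<close>
    then have "(\<Sum>C\<in>rcosets H. ?f C x) = 1 + (\<Sum>C\<in>rcosets H - {C}. ?f C x)"
      by (subst sum.remove[OF fin C]) simp
    moreover have "(\<Sum>C\<in>rcosets H - {C}. ?f C x) \<in> \<real>\<^sub>\<ge>\<^sub>0"
      using nonneg_Reals_of_nat_I[of "\<Sum>C\<in>rcosets H - {C}. of_bool (x \<otimes> inv (?r C) \<in> H)"] by simp
    ultimately show "(\<Sum>C\<in>rcosets H. ?f C x) - 1 \<in> \<real>\<^sub>\<ge>\<^sub>0" by simp
  qed
  also have "h (\<lambda>x. \<Sum>C\<in>rcosets H. ?f C x) = of_nat (card (rcosets H)) * h (\<lambda>x. of_bool (x \<in> H))"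
    by (simp add: haar_sum[OF h fin cont] inv)
  finally have "1 \<le> real (card (rcosets H)) * Re (h (\<lambda>x. of_bool (x \<in> H)))"
    using h unfolding is_haar_state_def by simp
  then show ?thesis using card_rcosets_pos[OF H(1) fin] by (simp add: field_simps)
qed

end

text \<open>Fixing one chain as a parameter lets the limit functional below refer to the same
  \<open>N\<close> throughout; the final theorem obtains such a chain and interprets this
  locale.\<close>

locale vilenkin_group_with_chain = topological_group +
  fixes N :: "nat \<Rightarrow> 'a set"
  assumes chain: "vilenkin_chain G T N"
begin

lemma normal_chain: "N n \<lhd> G" and openin_chain: "openin T (N n)"
  using chain unfolding vilenkin_chain_def by blast+

lemma subgroup_chain: "subgroup (N n) G"
  by (rule normal_imp_subgroup[OF normal_chain])

lemma compactin_carrier: "compactin T (carrier G)"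
  using chain unfolding vilenkin_chain_def by metis

lemma chain_antimono: "m \<le> n \<Longrightarrow> N n \<subseteq> N m"
  by (rule lift_Suc_antimono_le[of N]) (use chain in \<open>auto simp: vilenkin_chain_def\<close>)

lemma chain_basis: "openin T U \<Longrightarrow> \<one> \<in> U \<Longrightarrow> \<exists>n. N n \<subseteq> U"
  using chain unfolding vilenkin_chain_def by blast

lemma finite_rcosets_chain: "finite (rcosets (N n))"
  by (rule finite_rcosets[OF subgroup_chain openin_chain compactin_carrier])

text \<open>Right translation by \<open>x\<close> carries the neighbourhood basis at the identity to
  one at \<open>x\<close>.\<close>

lemma chain_nbhd:
  assumes "openin T U" "x \<in> U"
  shows "\<exists>n. N n #> x \<subseteq> U"
proof -
  have x: "x \<in> carrier G" using assms openin_subset topspace_eq by blast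
  have "openin T {y \<in> topspace T. y \<otimes> x \<in> U}"
    using continuous_map_right_translate[OF x] assms(1) by (rule openin_continuous_map_preimage)
  moreover have "\<one> \<in> {y \<in> topspace T. y \<otimes> x \<in> U}" using x assms by (simp add: topspace_eq)
  ultimately obtain n where "N n \<subseteq> {y \<in> topspace T. y \<otimes> x \<in> U}" using chain_basis by blast
  then show ?thesis by (auto simp: r_coset_def)
qed

text \<open>Compactness gives uniform continuity: finitely many cosets with oscillation control
  cover the group, and the largest of their depths works everywhere.\<close>

lemma ex_coset_osc_le:
  assumes f: "f \<in> cont_functions T" and "\<epsilon> > 0"
  shows "\<exists>n. coset_osc_le G (N n) \<epsilon> f"
proof -
  have "\<exists>n. \<forall>y \<in> N n #> x. norm (f y - f x) < \<epsilon> / 2" if x: "x \<in> carrier G" for x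
  proof -
    have "openin T {y \<in> topspace T. f y \<in> ball (f x) (\<epsilon> / 2)}"
      using f unfolding cont_functions_def
      by (intro openin_continuous_map_preimage) auto
    moreover have "x \<in> {y \<in> topspace T. f y \<in> ball (f x) (\<epsilon> / 2)}"
      using x \<open>\<epsilon> > 0\<close> by (simp add: topspace_eq)
    ultimately obtain n where "N n #> x \<subseteq> {y \<in> topspace T. f y \<in> ball (f x) (\<epsilon> / 2)}"
      using chain_nbhd by blast
    then have "\<forall>y \<in> N n #> x. norm (f y - f x) < \<epsilon> / 2"
      by (auto simp: dist_norm norm_minus_commute)
    then show ?thesis ..
  qed
  then obtain d where d: "\<And>x y. x \<in> carrier G \<Longrightarrow> y \<in> N (d x) #> x \<Longrightarrow> norm (f y - f x) < \<epsilon> / 2"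
    by metis
  have "\<exists>\<F>. finite \<F> \<and> \<F> \<subseteq> (\<lambda>x. N (d x) #> x) ` carrier G \<and> carrier G \<subseteq> \<Union>\<F>"
    using compactin_carrier openin_rcoset[OF subgroup_chain openin_chain] rcos_self[OF _ subgroup_chain]
    by (intro compactinD) auto
  then obtain \<F> where \<F>: "finite \<F>" "\<F> \<subseteq> (\<lambda>x. N (d x) #> x) ` carrier G" "carrier G \<subseteq> \<Union>\<F>"
    by blast
  obtain F where F: "finite F" "F \<subseteq> carrier G" "carrier G \<subseteq> (\<Union>x\<in>F. N (d x) #> x)"
    using finite_subset_image[OF \<F>(1,2)] \<F>(3) by auto
  obtain n where n: "\<And>x. x \<in> F \<Longrightarrow> d x \<le> n"
    using finite_nat_set_iff_bounded_le[of "d ` F"] F(1) by auto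
  have "coset_osc_le G (N n) \<epsilon> f"
    unfolding coset_osc_le_def
  proof (intro ballI)
    fix C y z assume C: "C \<in> rcosets (N n)" and yz: "y \<in> C" "z \<in> C"
    from C obtain a where a: "a \<in> carrier G" "C = N n #> a" by (auto simp: RCOSETS_def)
    obtain x where x: "x \<in> F" "a \<in> N (d x) #> x" using F(3) a by blast
    \<comment> \<open>Any element of a coset represents it, so the whole fine coset of
      \<open>a\<close> falls into the single covering coset of \<open>x\<close>, and both of its
      points are compared with \<open>f x\<close>.\<close>
    have "N n #> a \<subseteq> N (d x) #> a" using chain_antimono[OF n[OF x(1)]] by (auto simp: r_coset_def)
    also have "N (d x) #> a = N (d x) #> x"
      using repr_independence[OF x(2) _ subgroup_chain] x(1) F(2) by auto
    finally have "y \<in> N (d x) #> x" "z \<in> N (d x) #> x" using yz a by auto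
    then have "norm (f y - f x) < \<epsilon> / 2" "norm (f z - f x) < \<epsilon> / 2" using d x F(2) by auto
    then have "norm ((f y - f x) - (f z - f x)) \<le> \<epsilon> / 2 + \<epsilon> / 2"
      using norm_triangle_ineq4 order_trans by (smt (verit, best))
    then show "norm (f y - f z) \<le> \<epsilon>" by simp
  qed
  then show ?thesis ..
qed

section \<open>The Haar state as a limit of coset means\<close>

lemma convergent_coset_mean:
  assumes f: "f \<in> cont_functions T"
  shows "convergent (\<lambda>n. coset_mean G (N n) f)"
proof -
  have "Cauchy (\<lambda>n. coset_mean G (N n) f)"
  proof (rule metric_CauchyI)
    fix e :: real assume "e > 0"
    \<comment> \<open>Each later mean is within \<open>2 * (e / 5)\<close> of the mean at depth
      \<open>M\<close>, so two of them differ by at most \<open>4 * e / 5 < e\<close>.\<close>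
    then obtain M where M: "coset_osc_le G (N M) (e / 5) f" using ex_coset_osc_le[OF f, of "e / 5"] by auto
    have *: "norm (coset_mean G (N n) f - coset_mean G (N M) f) \<le> 2 * (e / 5)" if "n \<ge> M" for n
      by (rule norm_coset_mean_diff_subgroup_le[OF normal_chain finite_rcosets_chain normal_chain
          finite_rcosets_chain chain_antimono[OF that] M])
    have "dist (coset_mean G (N m) f) (coset_mean G (N n) f) < e" if "m \<ge> M" "n \<ge> M" for m n
      using *[OF that(1)] *[OF that(2)] \<open>e > 0\<close>
        dist_triangle2[of "coset_mean G (N m) f" "coset_mean G (N n) f" "coset_mean G (N M) f"]
      by (simp add: dist_norm)
    then show "\<exists>M. \<forall>m\<ge>M. \<forall>n\<ge>M. dist (coset_mean G (N m) f) (coset_mean G (N n) f) < e" by blast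
  qed
  then show ?thesis by (simp add: Cauchy_convergent_iff)
qed

text \<open>In the applications \<open>g\<close> is a translate of \<open>f\<close>. The oscillation
  of \<open>f\<close> tends to 0 along the chain, so the difference of the means does too, and the
  means of \<open>g\<close> inherit convergence from those of \<open>f\<close>.\<close>

lemma lim_coset_mean_shift:
  assumes f: "f \<in> cont_functions T"
    and shift: "\<And>n \<epsilon>. coset_osc_le G (N n) \<epsilon> f \<Longrightarrow>
      norm (coset_mean G (N n) g - coset_mean G (N n) f) \<le> \<epsilon>"
  shows "lim (\<lambda>n. coset_mean G (N n) g) = lim (\<lambda>n. coset_mean G (N n) f)"
proof -
  have diff: "(\<lambda>n. coset_mean G (N n) g - coset_mean G (N n) f) \<longlonglongrightarrow> 0"
  proof (rule LIMSEQ_I)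
    fix r :: real assume "r > 0"
    then obtain M where M: "coset_osc_le G (N M) (r / 2) f" using ex_coset_osc_le[OF f, of "r / 2"] by auto
    have "norm (coset_mean G (N n) g - coset_mean G (N n) f - 0) < r" if "n \<ge> M" for n
      using shift[OF coset_osc_le_subset[OF M chain_antimono[OF that]]] \<open>r > 0\<close> by simp
    then show "\<exists>no. \<forall>n\<ge>no. norm (coset_mean G (N n) g - coset_mean G (N n) f - 0) < r" by blast
  qed
  have "(\<lambda>n. coset_mean G (N n) f) \<longlonglongrightarrow> lim (\<lambda>n. coset_mean G (N n) f)"
    using convergent_coset_mean[OF f] by (simp add: convergent_LIMSEQ_iff)
  from tendsto_add[OF diff this]
  have "(\<lambda>n. coset_mean G (N n) g) \<longlonglongrightarrow> lim (\<lambda>n. coset_mean G (N n) f)"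
    by simp
  then show ?thesis by (rule limI)
qed

text \<open>Linearity passes to the limit, positivity survives because the nonnegative reals are
  closed, and the finite-level translation errors vanish.\<close>

lemma is_haar_state_lim_coset_mean: "is_haar_state G T (\<lambda>f. lim (\<lambda>n. coset_mean G (N n) f))"
proof -
  let ?h = "\<lambda>f. lim (\<lambda>n. coset_mean G (N n) f)"
  have conv: "(\<lambda>n. coset_mean G (N n) f) \<longlonglongrightarrow> ?h f" if "f \<in> cont_functions T" for f
    using convergent_coset_mean[OF that] by (simp add: convergent_LIMSEQ_iff)
  show ?thesis
    unfolding is_haar_state_def
  proof (intro conjI ballI allI impI)
    fix f g assume fg: "f \<in> cont_functions T" "g \<in> cont_functions T"
    show "?h (\<lambda>x. f x + g x) = ?h f + ?h g"
      unfolding coset_mean_add by (intro limI tendsto_add conv fg)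
  next
    fix c f assume f: "f \<in> cont_functions T"
    show "?h (\<lambda>x. c * f x) = c * ?h f"
      unfolding coset_mean_mult by (intro limI tendsto_mult tendsto_const conv f)
  next
    fix f assume f: "f \<in> cont_functions T" and pos: "\<forall>x\<in>carrier G. f x \<in> \<real>\<^sub>\<ge>\<^sub>0"
    have "coset_mean G (N n) f \<in> \<real>\<^sub>\<ge>\<^sub>0" for n
    proof -
      have "f (SOME x. x \<in> C) \<in> \<real>\<^sub>\<ge>\<^sub>0" if "C \<in> rcosets (N n)" for C
        using pos some_mem_rcoset[OF subgroup_chain that] rcoset_subset_carrier[OF subgroup_chain that]
        by blast
      then have "(\<Sum>C\<in>rcosets (N n). f (SOME x. x \<in> C)) \<in> \<real>\<^sub>\<ge>\<^sub>0"
        by (auto simp: complex_nonneg_Reals_iff intro: sum_nonneg)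
      then show ?thesis unfolding coset_mean_def by simp
    qed
    then show "?h f \<in> \<real>\<^sub>\<ge>\<^sub>0"
      using Lim_in_closed_set[OF closed_nonneg_Reals_complex _ _ conv[OF f]] by simp
  next
    show "?h (\<lambda>x. 1) = 1"
      by (simp add: coset_mean_const[OF subgroup_chain finite_rcosets_chain])
  next
    fix f g assume f: "f \<in> cont_functions T" and g: "g \<in> carrier G"
    show "?h (\<lambda>x. f (g \<otimes> x)) = ?h f"
      by (rule lim_coset_mean_shift[OF f norm_coset_mean_left_translate_le[OF normal_chain
          finite_rcosets_chain _ g]])
    show "?h (\<lambda>x. f (x \<otimes> g)) = ?h f"
      by (rule lim_coset_mean_shift[OF f norm_coset_mean_right_translate_le[OF subgroup_chain
          finite_rcosets_chain _ g]])
  qed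
qed

text \<open>Existence makes the choice in \<open>haar_state\<close> satisfy the axioms; the later
  estimates rely on these axioms alone.\<close>

lemma is_haar_state_haar_state: "is_haar_state G T (haar_state G T)"
  unfolding haar_state_def by (rule someI[of "is_haar_state G T", OF is_haar_state_lim_coset_mean])

end

section \<open>Symmetric representations\<close>

lemma sum_diag_mult_comm:
  fixes A B :: "'a :: comm_semiring_0 mat"
  assumes "A \<in> carrier_mat k k" "B \<in> carrier_mat k k"
  shows "(\<Sum>i<k. (A * B) $$ (i, i)) = (\<Sum>i<k. (B * A) $$ (i, i))"
proof -
  have "(\<Sum>i<k. (A * B) $$ (i, i)) = (\<Sum>i<k. \<Sum>j<k. A $$ (i, j) * B $$ (j, i))"
    using assms by (intro sum.cong) (auto simp: scalar_prod_def atLeast0LessThan)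
  also have "\<dots> = (\<Sum>j<k. \<Sum>i<k. B $$ (j, i) * A $$ (i, j))"
    by (subst sum.swap) (simp add: mult.commute)
  also have "\<dots> = (\<Sum>j<k. (B * A) $$ (j, j))"
    using assms by (intro sum.cong) (auto simp: scalar_prod_def atLeast0LessThan)
  finally show ?thesis .
qed

text \<open>Similar matrices have equal trace, so the trace of \<open>\<rho> x\<close> equals its
  own complex conjugate.\<close>

lemma sum_diag_real:
  assumes \<rho>: "fin_dim_rep G T k \<rho>" and eq: "equivalent_reps G k \<rho> (conj_rep \<rho>)"
    and x: "x \<in> carrier G"
  shows "(\<Sum>i<k. \<rho> x $$ (i, i)) \<in> \<real>"
proof -
  let ?A = "\<rho> x" and ?B = "map_mat cnj (\<rho> x)"
  have A: "?A \<in> carrier_mat k k" using \<rho> x unfolding fin_dim_rep_def by blast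
  then have B: "?B \<in> carrier_mat k k" by simp
  obtain P where P: "P \<in> carrier_mat k k" "invertible_mat P" "P * ?A = ?B * P"
    using eq x unfolding equivalent_reps_def conj_rep_def by blast
  then obtain Q where PQ: "P * Q = 1\<^sub>m k" and QP: "Q * P = 1\<^sub>m (dim_row Q)"
    unfolding invertible_mat_def inverts_mat_def by auto
  \<comment> \<open>\<open>invertible_mat\<close> leaves the shape of the inverse open; comparing
    column counts in \<open>PQ\<close> and \<open>QP\<close> fixes it.\<close>
  have Q: "Q \<in> carrier_mat k k"
    using arg_cong[OF PQ, of dim_col] arg_cong[OF QP, of dim_col] P(1) by auto
  have "?A = (Q * P) * ?A" using QP Q A by simp
  also have "\<dots> = Q * (?B * P)" using assoc_mult_mat[OF Q P(1) A] P(3) by simp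
  finally have "(\<Sum>i<k. ?A $$ (i, i)) = (\<Sum>i<k. (Q * (?B * P)) $$ (i, i))" by simp
  also have "\<dots> = (\<Sum>i<k. ((?B * P) * Q) $$ (i, i))"
    using Q B P(1) by (intro sum_diag_mult_comm) auto
  also have "(?B * P) * Q = ?B" using assoc_mult_mat[OF B P(1) Q] PQ B by simp
  also have "(\<Sum>i<k. ?B $$ (i, i)) = cnj (\<Sum>i<k. ?A $$ (i, i))" using A by simp
  finally show ?thesis by (simp add: Reals_cnj_iff)
qed

section \<open>Triviality on a deep subgroup and bounds on return probabilities\<close>

context vilenkin_group_with_chain
begin

text \<open>Write \<open>E = \<rho> x - 1\<close>. Since \<open>x \<otimes> x\<close> lies in the same subgroup and
  \<open>2 E = (\<rho> (x \<otimes> x) - 1) - E\<^sup>2\<close>, the supremum \<open>s\<close> of the entries of \<open>E\<close> over the subgroup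
  satisfies \<open>2 s \<le> s + k s\<^sup>2\<close>, which forces \<open>s = 0\<close> once \<open>s \<le> 1 / (2 k)\<close>.\<close>

lemma fin_dim_rep_trivial_on_chain:
  assumes \<rho>: "fin_dim_rep G T k \<rho>"
  shows "\<exists>m. \<forall>x\<in>N m. \<rho> x = 1\<^sub>m k"
proof -
  define E where "E x i j = \<rho> x $$ (i, j) - 1\<^sub>m k $$ (i, j)" for x i j
  have k: "k > 0" and one: "\<rho> \<one> = 1\<^sub>m k"
    and dim: "\<And>x. x \<in> carrier G \<Longrightarrow> \<rho> x \<in> carrier_mat k k"
    and mult: "\<And>x y. x \<in> carrier G \<Longrightarrow> y \<in> carrier G \<Longrightarrow> \<rho> (x \<otimes> y) = \<rho> x * \<rho> y"
    and cont: "\<And>i j. i < k \<Longrightarrow> j < k \<Longrightarrow> (\<lambda>x. \<rho> x $$ (i, j)) \<in> cont_functions T"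
    using \<rho> unfolding fin_dim_rep_def by blast+
  \<comment> \<open>The radius \<open>1 / (2 * real k)\<close> is chosen so that a sum of
    \<open>k\<close> products, each with one factor this small, is at most half the bound on the
    other factor.\<close>
  let ?U = "\<lambda>(i, j). {x \<in> topspace T. \<rho> x $$ (i, j) \<in> ball (1\<^sub>m k $$ (i, j)) (1 / (2 * real k))}"
  let ?I = "{..<k} \<times> {..<k}"
  have "openin T (\<Inter>p\<in>?I. ?U p)"
  proof (rule openin_INT2)
    show "openin T (?U p)" if "p \<in> ?I" for p :: "nat \<times> nat"
    proof -
      obtain i j where p: "p = (i, j)" "i < k" "j < k" using \<open>p \<in> ?I\<close> by auto
      show ?thesis
        unfolding p(1) case_prod_conv
        using cont[OF p(2,3)] unfolding cont_functions_def mem_Collect_eq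
        by (rule openin_continuous_map_preimage) simp
    qed
  qed (use k in auto)
  moreover have "\<one> \<in> (\<Inter>p\<in>?I. ?U p)" using one k by (auto simp: topspace_eq)
  ultimately obtain m where "N m \<subseteq> (\<Inter>p\<in>?I. ?U p)" using chain_basis by blast
  then have small: "norm (E x i j) \<le> 1 / (2 * real k)" if "x \<in> N m" "i < k" "j < k" for x i j
    using that unfolding E_def by (force simp: dist_norm norm_minus_commute)
  have sub: "x \<in> carrier G" if "x \<in> N m" for x
    using that subgroup.mem_carrier[OF subgroup_chain] by blast
  have square: "E (x \<otimes> x) i j = 2 * E x i j + (\<Sum>l<k. E x i l * E x l j)"
    if x: "x \<in> N m" and ij: "i < k" "j < k" for x i j
  proof -
    have A: "\<rho> x \<in> carrier_mat k k" using dim sub x by blast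
    have d: "1\<^sub>m k $$ (a, b) = (if a = b then 1 else 0 :: complex)" if "a < k" "b < k" for a b
      using that by simp
    have "\<rho> (x \<otimes> x) $$ (i, j) = (\<Sum>l<k. \<rho> x $$ (i, l) * \<rho> x $$ (l, j))"
      using A ij mult[OF sub[OF x] sub[OF x]] by (auto simp: scalar_prod_def atLeast0LessThan)
    \<comment> \<open>The expansion of \<open>(E + 1)(E + 1)\<close> entry by entry, with the
      Kronecker deltas as conditionals so that their sums collapse.\<close>
    also have "\<dots> = (\<Sum>l<k. E x i l * E x l j + (if i = l then \<rho> x $$ (l, j) else 0)
        + (if l = j then \<rho> x $$ (i, l) else 0) - (if i = l then 1\<^sub>m k $$ (l, j) else 0))"
      using ij by (intro sum.cong) (auto simp: E_def d algebra_simps)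
    also have "\<dots> = (\<Sum>l<k. E x i l * E x l j) + \<rho> x $$ (i, j) + \<rho> x $$ (i, j) - 1\<^sub>m k $$ (i, j)"
      using ij by (simp add: sum.distrib sum_subtractf del: index_one_mat)
    finally show ?thesis by (simp add: E_def algebra_simps del: index_one_mat)
  qed
  define S where "S = (\<lambda>(x, i, j). norm (E x i j)) ` (N m \<times> {..<k} \<times> {..<k})"
  have S: "bdd_above S" "S \<noteq> {}"
    using small k subgroup.one_closed[OF subgroup_chain, of m] unfolding S_def
    by (auto intro!: bdd_aboveI2)
  have le: "norm (E x i j) \<le> Sup S" if "x \<in> N m" "i < k" "j < k" for x i j
    using that by (intro cSup_upper S) (force simp: S_def)
  \<comment> \<open>From \<open>2 * s \<le> Sup S + Sup S / 2\<close>: the first term bounds the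
    entry at \<open>x \<otimes> x\<close>, the second the quadratic sum. The factor below 1 then
    forces \<open>Sup S \<le> 0\<close>.\<close>
  have "s \<le> 3 / 4 * Sup S" if "s \<in> S" for s
  proof -
    from that obtain x i j where x: "x \<in> N m" "i < k" "j < k" and s: "s = norm (E x i j)"
      by (auto simp: S_def)
    have "x \<otimes> x \<in> N m" using x subgroup.m_closed[OF subgroup_chain] by blast
    then have 1: "norm (E (x \<otimes> x) i j) \<le> Sup S" using le x by blast
    have "norm (\<Sum>l<k. E x i l * E x l j) \<le> of_nat (card {..<k}) * (1 / (2 * real k) * Sup S)"
    proof (rule sum_norm_bound)
      fix l assume "l \<in> {..<k}"
      then have "norm (E x i l) \<le> 1 / (2 * real k)" "norm (E x l j) \<le> Sup S"
        using x by (auto intro: small le)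
      then show "norm (E x i l * E x l j) \<le> 1 / (2 * real k) * Sup S"
        unfolding norm_mult by (intro mult_mono) auto
    qed
    then have 2: "norm (\<Sum>l<k. E x i l * E x l j) \<le> Sup S / 2" using k by simp
    have "2 * E x i j = E (x \<otimes> x) i j - (\<Sum>l<k. E x i l * E x l j)"
      using square[OF x] by simp
    then have "norm (2 * E x i j) \<le> Sup S + Sup S / 2"
      using norm_triangle_ineq4[of "E (x \<otimes> x) i j" "\<Sum>l<k. E x i l * E x l j"] 1 2 by simp
    then show ?thesis using s by (simp add: norm_mult)
  qed
  then have "Sup S \<le> 3 / 4 * Sup S" using S by (intro cSup_least)
  have zero: "E x i j = 0" if "x \<in> N m" "i < k" "j < k" for x i j
  proof -
    have "norm (E x i j) \<le> 0" using le[OF that] \<open>Sup S \<le> 3 / 4 * Sup S\<close> by linarith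
    then show ?thesis by simp
  qed
  have "\<rho> x = 1\<^sub>m k" if "x \<in> N m" for x
    using zero[OF that] dim[OF sub[OF that]] by (intro eq_matI) (auto simp: E_def)
  then show ?thesis by blast
qed

text \<open>The pointwise bound of the character power by \<open>?K * ?ind x\<close> is integrated.
  The resulting \<open>c\<close>, the inverse index of \<open>N m\<close>, is independent of
  \<open>n\<close>.\<close>

lemma return_prob_ge:
  assumes "(k, \<rho>) \<in> sym_reps G T"
  shows "\<exists>c>0. \<forall>n. c \<le> return_prob G T k \<rho> n"
proof -
  have \<rho>: "fin_dim_rep G T k \<rho>" and eq: "equivalent_reps G k \<rho> (conj_rep \<rho>)"
    using assms by (auto simp: sym_reps_def)
  have k: "k > 0" and cont: "\<And>i. i < k \<Longrightarrow> (\<lambda>x. \<rho> x $$ (i, i)) \<in> cont_functions T"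
    using \<rho> unfolding fin_dim_rep_def by blast+
  obtain m where m: "\<And>x. x \<in> N m \<Longrightarrow> \<rho> x = 1\<^sub>m k"
    using fin_dim_rep_trivial_on_chain[OF \<rho>] by blast
  let ?h = "haar_state G T"
  let ?\<chi> = "\<lambda>x. \<Sum>i<k. \<rho> x $$ (i, i)"
  let ?ind = "\<lambda>x. of_bool (x \<in> N m) :: complex"
  let ?c = "1 / real (card (rcosets (N m)))"
  have ind: "?ind \<in> cont_functions T" by (rule cont_functions_indicator[OF subgroup_chain openin_chain])
  have \<chi>: "?\<chi> \<in> cont_functions T" using cont by (intro cont_functions_sum) auto
  have "?c \<le> return_prob G T k \<rho> n" for n
  proof -
    let ?K = "complex_of_real (real k ^ (2 * n))"
    have "Re (?h (\<lambda>x. ?K * ?ind x)) \<le> Re (?h (\<lambda>x. ?\<chi> x ^ (2 * n)))"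
    proof (rule haar_mono[OF is_haar_state_haar_state])
      show "(\<lambda>x. ?K * ?ind x) \<in> cont_functions T" by (rule cont_functions_mult_left[OF ind])
      show "(\<lambda>x. ?\<chi> x ^ (2 * n)) \<in> cont_functions T"
        by (rule cont_functions_compose[OF \<chi>]) (intro continuous_intros)
      fix x assume x: "x \<in> carrier G"
      show "?\<chi> x ^ (2 * n) - ?K * ?ind x \<in> \<real>\<^sub>\<ge>\<^sub>0"
      proof (cases "x \<in> N m")
        case True
        then show ?thesis by (simp add: m)
      next
        case False
        \<comment> \<open>Symmetry of the representation enters here: an even power of a real number
          is nonnegative.\<close>
        obtain r where "?\<chi> x = complex_of_real r" using sum_diag_real[OF \<rho> eq x] by (auto elim: Reals_cases)
        then have "?\<chi> x ^ (2 * n) = complex_of_real (r ^ (2 * n))" by simp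
        then show ?thesis using False by (simp del: of_real_power)
      qed
    qed
    also have "?h (\<lambda>x. ?K * ?ind x) = ?K * ?h ?ind"
      by (rule haar_mult_left[OF is_haar_state_haar_state ind])
    finally have "real k ^ (2 * n) * Re (?h ?ind) \<le> Re (?h (\<lambda>x. ?\<chi> x ^ (2 * n)))"
      by (simp del: of_real_power)
    then have "Re (?h ?ind) \<le> return_prob G T k \<rho> n"
      using k by (simp add: return_prob_def field_simps)
    then show ?thesis
      using haar_indicator_ge[OF is_haar_state_haar_state subgroup_chain openin_chain finite_rcosets_chain]
        order_trans by blast
  qed
  moreover have "?c > 0" using card_rcosets_pos[OF subgroup_chain finite_rcosets_chain] by simp
  ultimately show ?thesis by blast
qed

section \<open>The random walk dimension\<close>

lemma limsup_return_prob_le: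
  assumes "(k, \<rho>) \<in> sym_reps G T"
  shows "limsup (\<lambda>n. ereal (- 2 * ln (return_prob G T k \<rho> n) / ln (real n))) \<le> 0"
proof -
  obtain c where c: "c > 0" "\<And>n. c \<le> return_prob G T k \<rho> n" using return_prob_ge[OF assms] by blast
  have "(\<lambda>n. - 2 * ln c / ln (real n)) \<longlonglongrightarrow> 0"
    by (intro tendsto_divide_0[OF tendsto_const] filterlim_at_top_imp_at_infinity
        filterlim_compose[OF ln_at_top filterlim_real_sequentially])
  then have "(\<lambda>n. ereal (- 2 * ln c / ln (real n))) \<longlonglongrightarrow> ereal 0" by (simp only: tendsto_ereal)
  then have lim: "limsup (\<lambda>n. ereal (- 2 * ln c / ln (real n))) = 0"
    by (simp add: lim_imp_Limsup zero_ereal_def)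
  have "\<forall>\<^sub>F n in sequentially. - 2 * ln (return_prob G T k \<rho> n) / ln (real n) \<le> - 2 * ln c / ln (real n)"
    \<comment> \<open>For \<open>n \<ge> 2\<close> the denominator \<open>ln (real n)\<close> is
      positive, so division keeps the inequality.\<close>
    using eventually_ge_at_top[of 2]
  proof eventually_elim
    case (elim n)
    have "ln c \<le> ln (return_prob G T k \<rho> n)" using c order_less_le_trans[OF c(1) c(2)] by simp
    then show ?case using elim by (intro divide_right_mono) auto
  qed
  then have "limsup (\<lambda>n. ereal (- 2 * ln (return_prob G T k \<rho> n) / ln (real n)))
      \<le> limsup (\<lambda>n. ereal (- 2 * ln c / ln (real n)))"
    by (intro Limsup_mono) simp
  then show ?thesis by (simp only: lim)
qed

text \<open>This member of the supremum's index set supplies the lower bound 0.\<close>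

lemma trivial_rep_sym: "(1, \<lambda>x. 1\<^sub>m 1) \<in> sym_reps G T"
proof -
  have "fin_dim_rep G T 1 (\<lambda>x. 1\<^sub>m 1)" by (simp add: fin_dim_rep_def)
  moreover have "equivalent_reps G 1 (\<lambda>x. 1\<^sub>m 1) (conj_rep (\<lambda>x. 1\<^sub>m 1))"
  proof -
    have "conj_rep (\<lambda>x. 1\<^sub>m 1) = (\<lambda>x :: 'a. 1\<^sub>m 1)"
      by (rule ext, rule eq_matI) (auto simp: conj_rep_def)
    moreover have "invertible_mat (1\<^sub>m 1 :: complex mat)"
      unfolding invertible_mat_def inverts_mat_def by (auto intro!: exI[of _ "1\<^sub>m 1"])
    ultimately show ?thesis unfolding equivalent_reps_def by auto
  qed
  ultimately show ?thesis by (simp add: sym_reps_def)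
qed

lemma return_prob_trivial_rep: "return_prob G T 1 (\<lambda>x. 1\<^sub>m 1) n = 1"
  using is_haar_state_haar_state by (simp add: return_prob_def is_haar_state_def)

lemma rw_dim_eq_0: "rw_dim G T = 0"
proof (rule antisym)
  show "rw_dim G T \<le> 0"
    unfolding rw_dim_def
  proof (rule SUP_least)
    fix p assume "p \<in> sym_reps G T"
    moreover obtain k \<rho> where "p = (k, \<rho>)" by (cases p)
    ultimately show "(case p of (k, \<rho>) \<Rightarrow>
        limsup (\<lambda>n. ereal (- 2 * ln (return_prob G T k \<rho> n) / ln (real n)))) \<le> 0"
      using limsup_return_prob_le[of k \<rho>] by (simp only: case_prod_conv)
  qed
  \<comment> \<open>Since \<open>ln 1 = 0\<close>, every term is 0, including those at
    \<open>n = 0\<close> and \<open>n = 1\<close>, where division by zero gives 0.\<close>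
  have "0 = limsup (\<lambda>n. ereal (- 2 * ln (return_prob G T 1 (\<lambda>x. 1\<^sub>m 1) n) / ln (real n)))"
    unfolding return_prob_trivial_rep by (simp add: Limsup_const zero_ereal_def[symmetric])
  also have "\<dots> \<le> rw_dim G T"
    unfolding rw_dim_def by (rule SUP_upper2[OF trivial_rep_sym]) simp
  finally show "0 \<le> rw_dim G T" .
qed

end

theorem theorem3p10:
  fixes G :: "('a, 'b) monoid_scheme" and T :: "'a topology"
  assumes "compact_vilenkin_group G T"
  shows "rw_dim G T = 0"
proof -
  interpret compact_vilenkin_group G T by fact
  obtain N where "vilenkin_chain G T N" using ex_vilenkin_chain by blast
  then interpret vilenkin_group_with_chain G T N by unfold_locales
  show ?thesis by (rule rw_dim_eq_0)
qed

end
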